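(* Consider the functional Berkson logistic regression model with unknown error variance $\tau^2$ and nonrandom surrogate regressors $X^{\rm obs}_1,\dots,X^{\rm obs}_N\in\mathbb{R}$. If there are four different values among $X^{\rm obs}_1,\dots,X^{\rm obs}_N$, then the parameters $\vec\beta$ and $\beta_1^2\tau^2$ are identifiable; that is, if $(\vec\beta^{(1)},(\tau^{(1)})^2)$ and $(\vec\beta^{(2)},(\tau^{(2)})^2)$ are two parameter sets in $\mathbb{R}^2\times[0,\infty)$ for which the distributions of the observations $(Y_1,\dots,Y_N)$ coincide, then $\vec\beta^{(1)}=\vec\beta^{(2)}$ and $(\beta_1^{(1)})^2(\tau^{(1)})^2=(\beta_1^{(2)})^2(\tau^{(2)})^2$.
   Context: Functional Berkson logistic regression model: $X^{\rm obs}_1,\dots,X^{\rm obs}_N$ are given (nonrandom) real numbers. The true regressors are $X_n=X^{\rm obs}_n+U_n$ with $U_n\sim N(0,\tau^2)$, $\tau^2\ge 0$ (for $\tau^2=0$, $U_n=0$ almost surely). The response $Y_n\in\{0,1\}$ satisfies $$P(Y_n=1\mid X^{\rm obs}_n,X_n)=\frac{\exp(\beta_0+\beta_1X_n)}{1+\exp(\beta_0+\beta_1X_n)}.$$ The trials $n=1,\dots,N$ are independent. The pairs $(X^{\rm obs}_n,Y_n)$, $n=1,\dots,N$, are observed; the $X_n$ are not. The unknown parameters are $\vec\beta=(\beta_0,\beta_1)^\top\in\mathbb{R}^2$ and $\tau^2\ge0$. A function of the parameters is identifiable if it takes equal values at any two parameter sets giving the same distribution of the observations. *)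

theory Defs
  imports "HOL-Probability.Probability"
begin

text \<open>The centred normal law with variance \<open>v \<ge> 0\<close>; for \<open>v = 0\<close> it is the point mass at 0
  (\<^const>\<open>normal_density\<close> takes the standard deviation and degenerates there).\<close>

definition normal_law :: "real \<Rightarrow> real measure" where
  "normal_law v =
     (if v = 0 then return borel 0 else density lborel (\<lambda>u. ennreal (normal_density 0 (sqrt v) u)))"

definition logistic :: "real \<Rightarrow> real" where
  "logistic t = exp t / (1 + exp t)"

text \<open>The locale parameter \<open>tausq\<close> is the variance \<open>\<tau>\<^sup>2\<close> itself, and \<open>U n\<close> is the error in
  \<open>X n = xobs n + U n\<close>.  Since \<open>xobs n\<close> is nonrandom, conditioning on the pair
  \<open>(xobs n, X n)\<close> is conditioning on the sigma-algebra generated by \<open>X n\<close>.\<close>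

locale berkson_logistic = prob_space M
  for M :: "'a measure" +
  fixes N :: nat and xobs :: "nat \<Rightarrow> real"
    and beta0 beta1 tausq :: real
    and U :: "nat \<Rightarrow> 'a \<Rightarrow> real" and Y :: "nat \<Rightarrow> 'a \<Rightarrow> nat"
  assumes tausq_nonneg: "0 \<le> tausq"
    and U_measurable: "\<And>n. n \<in> {1..N} \<Longrightarrow> random_variable borel (U n)"
    and U_law: "\<And>n. n \<in> {1..N} \<Longrightarrow> distr M borel (U n) = normal_law tausq"
    and Y_measurable: "\<And>n. n \<in> {1..N} \<Longrightarrow> random_variable (count_space {0, 1}) (Y n)"
    and Y_cond_prob: "\<And>n. n \<in> {1..N} \<Longrightarrow>
      (AE \<omega> in M.
         real_cond_exp M (vimage_algebra (space M) (\<lambda>\<omega>. xobs n + U n \<omega>) borel)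
           (indicator {\<omega> \<in> space M. Y n \<omega> = 1}) \<omega>
         = logistic (beta0 + beta1 * (xobs n + U n \<omega>)))"
    and trials_indep:
      "indep_vars (\<lambda>_. borel \<Otimes>\<^sub>M count_space {0, 1}) (\<lambda>n \<omega>. (U n \<omega>, Y n \<omega>)) {1..N}"

definition obs_law :: "'a measure \<Rightarrow> nat \<Rightarrow> (nat \<Rightarrow> 'a \<Rightarrow> nat) \<Rightarrow> (nat \<Rightarrow> nat) measure" where
  "obs_law M N Y =
     distr M (Pi\<^sub>M {1..N} (\<lambda>_. count_space {0, 1})) (\<lambda>\<omega>. \<lambda>n\<in>{1..N}. Y n \<omega>)"

end

theory Submission
  imports Defs
begin

text \<open>
  Let \<open>F\<^sub>i(x)\<close> be the success probability at surrogate value \<open>x\<close> for the \<open>i\<close>-th parameter set, i.e. the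
  convolution of \<open>x \<mapsto> logistic (\<beta>\<^sub>0 + \<beta>\<^sub>1 x)\<close> with the normal law of variance \<open>\<tau>\<^sup>2\<close>.  Let \<open>v \<le> w\<close> be
  the two variances.  By the semigroup property \<open>F\<^sub>1 - F\<^sub>2\<close> is the smoothing with variance \<open>v\<close> of
  \<open>D\<close>, the difference of an unsmoothed logistic curve and one smoothed with variance \<open>w - v\<close>.

  A bilateral Laplace transform has no more real zeros than its weight has sign changes (Descartes'
  rule, by Rolle's theorem).  Since the Gaussian kernel is \<open>exp (x y / v)\<close> up to factors depending on
  \<open>x\<close> or \<open>y\<close> alone, Gaussian smoothing does not increase the number of zeros, so it suffices that
  \<open>D\<close> has at most three zeros.  For \<open>v < w\<close> and nonzero slopes, \<open>D\<close> is, up to a nonzero factor, again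
  a Laplace transform; the zeros of its weight are those of a logarithmic ratio of logistic
  functions whose second derivative vanishes exactly once.
\<close>

subsection \<open>Zeros of Laplace transforms\<close>

text \<open>Two consecutive zeros of \<open>f\<close> enclose a zero of \<open>f'\<close>. Since
  finiteness of the zero set is itself at stake, the bound is shown uniformly for its finite
  subsets, which yields both claims.\<close>

lemma rolle_zeros_finite:
  fixes f f' :: "real \<Rightarrow> real"
  assumes deriv: "\<And>x. (f has_real_derivative f' x) (at x)"
    and fin': "finite {x. f' x = 0}"
  shows "finite {x. f x = 0} \<and> card {x. f x = 0} \<le> Suc (card {x. f' x = 0})"
proof (rule finite_if_finite_subsets_card_bdd)
  have between: "\<exists>z. a < z \<and> z < b \<and> f' z = 0" if "a < b" "f a = 0" "f b = 0" for a b
  proof -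
    have "continuous_on {a..b} f"
      using deriv by (meson DERIV_continuous_on DERIV_subset subset_UNIV)
    moreover have "f differentiable at x" for x
      using deriv real_differentiable_def by blast
    moreover have "f a = f b" using that by simp
    ultimately have "\<exists>z>a. z < b \<and> DERIV f z :> 0"
      using Rolle that(1) by blast
    then show ?thesis
      using deriv DERIV_unique by blast
  qed
  \<comment> \<open>Points are added in increasing order. The clause \<open>z < Max T\<close> keeps
    the Rolle zero found beyond the old maximum distinct from the earlier ones.\<close>
  have interlace: "\<exists>T'. finite T' \<and> card T \<le> Suc (card T') \<and> (\<forall>z\<in>T'. f' z = 0 \<and> z < Max T)"
    if "finite T" "T \<noteq> {}" "\<forall>x\<in>T. f x = 0" for T
    using that
  proof (induction T rule: finite_linorder_max_induct)
    case empty
    then show ?case by simp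
  next
    case (insert b A)
    show ?case
    proof (cases "A = {}")
      case True
      then show ?thesis by (intro exI[of _ "{}"]) auto
    next
      case False
      with insert obtain T' where T': "finite T'" "card A \<le> Suc (card T')"
        "\<forall>z\<in>T'. f' z = 0 \<and> z < Max A" by auto
      have "Max A \<in> A" using False insert by simp
      with insert obtain z where z: "Max A < z" "z < b" "f' z = 0"
        using between[of "Max A" b] by auto
      have "Max (insert b A) = b"
        using insert by (intro Max_eqI) auto
      moreover have "z \<notin> T'" "b \<notin> A" using T' z insert by auto
      ultimately show ?thesis
        using T' z insert by (intro exI[of _ "insert z T'"]) auto
    qed
  qed
  fix T assume "T \<subseteq> {x. f x = 0}" "finite T"
  show "card T \<le> Suc (card {x. f' x = 0})"
  proof (cases "T = {}")
    case False
    with interlace[of T] \<open>T \<subseteq> _\<close> \<open>finite T\<close> obtain T' where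
      "card T \<le> Suc (card T')" "\<forall>z\<in>T'. f' z = 0" by auto
    moreover have "card T' \<le> card {x. f' x = 0}"
      using calculation fin' by (intro card_mono) auto
    ultimately show ?thesis by linarith
  qed simp
qed

section \<open>Sign changes of a continuous function with finitely many zeros\<close>

text \<open>The sets of points where one or the other alternative holds are open and, as
  \<open>at y\<close> is a nontrivial filter, disjoint; connectedness of the line decides between
  them. Punctured filters let \<open>f\<close> vanish at isolated points.\<close>

lemma punctured_sign_global:
  fixes f :: "real \<Rightarrow> real"
  assumes "\<And>y. (\<forall>\<^sub>F z in at y. 0 < f z) \<or> (\<forall>\<^sub>F z in at y. f z < 0)"
  shows "(\<forall>y. \<forall>\<^sub>F z in at y. 0 < f z) \<or> (\<forall>y. \<forall>\<^sub>F z in at y. f z < 0)"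
proof -
  have open_ev: "open {y. \<forall>\<^sub>F z in at y. P z}" for P :: "real \<Rightarrow> bool"
  proof (subst open_subopen, rule ballI)
    fix y assume "y \<in> {y. \<forall>\<^sub>F z in at y. P z}"
    then obtain S where S: "open S" "y \<in> S" "\<forall>z\<in>S. z \<noteq> y \<longrightarrow> P z"
      unfolding eventually_at_topological by auto
    have "S \<subseteq> {y. \<forall>\<^sub>F z in at y. P z}"
    proof
      fix x assume "x \<in> S"
      show "x \<in> {y. \<forall>\<^sub>F z in at y. P z}"
      proof (cases "x = y")
        case True
        with S show ?thesis unfolding eventually_at_topological by auto
      next
        case False
        have "open (S - {y})" using S(1) by (simp add: open_delete)
        with S False \<open>x \<in> S\<close> show ?thesis
          unfolding mem_Collect_eq eventually_at_topological
          by (intro exI[of _ "S - {y}"]) auto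
      qed
    qed
    with S show "\<exists>T. open T \<and> y \<in> T \<and> T \<subseteq> {y. \<forall>\<^sub>F z in at y. P z}" by blast
  qed
  let ?A = "{y. \<forall>\<^sub>F z in at y. 0 < f z}" and ?B = "{y. \<forall>\<^sub>F z in at y. f z < 0}"
  have "?A \<inter> ?B = {}"
  proof -
    have "\<not> (\<forall>\<^sub>F z in at y. f z < 0)" if "\<forall>\<^sub>F z in at y. 0 < f z" for y
    proof
      assume "\<forall>\<^sub>F z in at y. f z < 0"
      with that have "\<forall>\<^sub>F z in at y. False" by eventually_elim simp
      then show False by simp
    qed
    then show ?thesis by blast
  qed
  moreover have "?A \<union> ?B = UNIV" using assms by auto
  ultimately have "?A = {} \<or> ?B = {}"
    using connectedD[OF connected_UNIV open_ev open_ev, of "\<lambda>z. 0 < f z" "\<lambda>z. f z < 0"] by auto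
  then show ?thesis using assms by blast
qed

text \<open>Finitely many zeros leave an interval to the right of \<open>y\<close> free of them, and
  there the intermediate value theorem fixes the sign.\<close>

lemma sign_right:
  fixes f :: "real \<Rightarrow> real"
  assumes cont: "continuous_on UNIV f" and fin: "finite {x. f x = 0}"
  shows "(\<forall>\<^sub>F z in at_right y. 0 < f z) \<or> (\<forall>\<^sub>F z in at_right y. f z < 0)"
proof -
  have "finite {x. f x = 0 \<and> x \<noteq> y}" using fin by (rule rev_finite_subset) auto
  then have "open (- {x. f x = 0 \<and> x \<noteq> y})" by (simp add: finite_imp_closed open_Compl)
  then obtain d where d: "d > 0" "ball y d \<subseteq> - {x. f x = 0 \<and> x \<noteq> y}"
    by (metis (mono_tags, lifting) ComplI mem_Collect_eq open_contains_ball)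
  have nz: "f z \<noteq> 0" if "y < z" "z < y + d" for z
  proof -
    have "z \<in> ball y d" using that by (simp add: dist_real_def)
    then show ?thesis using d(2) that by auto
  qed
  have same: "0 < f z \<longleftrightarrow> 0 < f (y + d/2)" if "y < z" "z < y + d" for z
  proof (rule ccontr)
    assume neq: "\<not> ?thesis"
    have "connected (f ` {min z (y + d/2)..max z (y + d/2)})"
      by (intro connected_continuous_image continuous_on_subset[OF cont] connected_Icc) auto
    moreover have "f z \<in> f ` {min z (y + d/2)..max z (y + d/2)}"
      "f (y+d/2) \<in> f ` {min z (y + d/2)..max z (y + d/2)}" by auto
    moreover have "(f z \<le> 0 \<and> 0 \<le> f (y+d/2)) \<or> (f (y+d/2) \<le> 0 \<and> 0 \<le> f z)"
      using neq by auto
    ultimately have "0 \<in> f ` {min z (y + d/2)..max z (y + d/2)}"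
      unfolding connected_iff_interval by blast
    then obtain t where "f t = 0" "min z (y + d/2) \<le> t" "t \<le> max z (y + d/2)" by auto
    then show False using nz[of t] that d(1) by (auto simp: min_def max_def split: if_splits)
  qed
  have ev: "\<forall>\<^sub>F z in at_right y. y < z \<and> z < y + d"
    using d(1) by (intro eventually_conj eventually_at_right_less)
      (auto simp: eventually_at_right_field intro!: exI[of _ "y + d"])
  show ?thesis
  proof (cases "0 < f (y + d/2)")
    case True
    with ev same have "\<forall>\<^sub>F z in at_right y. 0 < f z" by (auto elim!: eventually_mono)
    then show ?thesis ..
  next
    case False
    have "f z < 0" if "y < z" "z < y + d" for z
      using same[OF that] nz[OF that] False by auto
    with ev have "\<forall>\<^sub>F z in at_right y. f z < 0" by (auto elim!: eventually_mono)
    then show ?thesis ..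
  qed
qed

lemma sign_left:
  fixes f :: "real \<Rightarrow> real"
  assumes cont: "continuous_on UNIV f" and fin: "finite {x. f x = 0}"
  shows "(\<forall>\<^sub>F z in at_left y. 0 < f z) \<or> (\<forall>\<^sub>F z in at_left y. f z < 0)"
proof -
  have "{x. f (- x) = 0} = uminus ` {x. f x = 0}"
    by (auto simp: image_iff) (metis minus_minus)
  then have "finite {x. f (- x) = 0}" using fin by simp
  moreover have "continuous_on UNIV (\<lambda>x. f (- x))"
    by (intro continuous_on_compose2[OF cont] continuous_intros) auto
  ultimately show ?thesis
    using sign_right[of "\<lambda>x. f (- x)" "- y"] by (simp add: eventually_at_left_to_right)
qed

text \<open>One factor \<open>y - c\<close> for each point where \<open>f\<close> changes sign
  compensates all changes; \<open>e\<close> is the sign that remains.\<close>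

lemma sign_changes:
  fixes f :: "real \<Rightarrow> real"
  assumes cont: "continuous_on UNIV f" and fin: "finite {x. f x = 0}"
  obtains C e where "C \<subseteq> {x. f x = 0}" "e = 1 \<or> e = (- 1 :: real)"
    "\<And>y. 0 \<le> e * f y * (\<Prod>c\<in>C. y - c)"
proof -
  \<comment> \<open>Points with no fixed sign on a punctured neighbourhood; zeros at which
    \<open>f\<close> keeps its sign are left out.\<close>
  define C where "C = {y. \<not> (\<forall>\<^sub>F z in at y. 0 < f z) \<and> \<not> (\<forall>\<^sub>F z in at y. f z < 0)}"
  have C: "C \<subseteq> {x. f x = 0}"
  proof
    fix y assume "y \<in> C"
    have lim: "(f \<longlongrightarrow> f y) (at y)" using cont by (simp add: continuous_on_def)
    then show "y \<in> {x. f x = 0}"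
      using \<open>y \<in> C\<close> order_tendstoD[OF lim, of 0] unfolding C_def by (cases "f y" "0::real" rule: linorder_cases) auto
  qed
  have finC: "finite C" using C fin finite_subset by blast
  let ?P = "\<lambda>y. \<Prod>c\<in>C. y - c"
  let ?g = "\<lambda>y. f y * ?P y"
  have "(\<forall>\<^sub>F z in at y. 0 < ?g z) \<or> (\<forall>\<^sub>F z in at y. ?g z < 0)" for y
  proof -
    \<comment> \<open>The factors other than the one for \<open>y\<close> itself do not vanish at
      \<open>y\<close>, so their product has a fixed sign nearby.\<close>
    let ?Q = "\<lambda>z. \<Prod>c\<in>C - {y}. z - c"
    have lim: "(?Q \<longlongrightarrow> ?Q y) (at y)" by (intro tendsto_intros)
    have "?Q y \<noteq> 0" using finC by simp
    then have Q: "(\<forall>\<^sub>F z in at y. 0 < ?Q z) \<or> (\<forall>\<^sub>F z in at y. ?Q z < 0)"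
      using order_tendstoD[OF lim, of 0] by (cases "?Q y" "0::real" rule: linorder_cases) auto
    have eq: "?g z = f z * (if y \<in> C then z - y else 1) * ?Q z" for z
      using finC by (auto simp: prod.remove)
    have "(\<forall>\<^sub>F z in at y. 0 < f z * (if y \<in> C then z - y else 1)) \<or>
          (\<forall>\<^sub>F z in at y. f z * (if y \<in> C then z - y else 1) < 0)"
    proof (cases "y \<in> C")
      case False
      then show ?thesis unfolding C_def by auto
    next
      case True
      have r: "\<forall>\<^sub>F z in at_right y. 0 < z - y"
        using eventually_at_right_less[of y] by eventually_elim auto
      have l: "\<forall>\<^sub>F z in at_left y. z - y < 0"
        unfolding eventually_at_filter by auto
      \<comment> \<open>Both one-sided signs exist, and for \<open>y\<close> in \<open>C\<close>
        they must be opposite; the factor \<open>z - y\<close> reconciles them.\<close>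
      consider (pn) "\<forall>\<^sub>F z in at_left y. 0 < f z" "\<forall>\<^sub>F z in at_right y. f z < 0"
        | (np) "\<forall>\<^sub>F z in at_left y. f z < 0" "\<forall>\<^sub>F z in at_right y. 0 < f z"
        using True sign_left[OF cont fin, of y] sign_right[OF cont fin, of y]
        unfolding C_def eventually_at_split by auto
      then show ?thesis
      proof cases
        case pn
        have "\<forall>\<^sub>F z in at_left y. f z * (z - y) < 0"
          using pn(1) l by eventually_elim (simp add: mult_pos_neg)
        moreover have "\<forall>\<^sub>F z in at_right y. f z * (z - y) < 0"
          using pn(2) r by eventually_elim (simp add: mult_neg_pos)
        ultimately show ?thesis using True by (simp add: eventually_at_split)
      next
        case np
        have "\<forall>\<^sub>F z in at_left y. f z * (z - y) > 0"
          using np(1) l by eventually_elim (simp add: mult_neg_neg)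
        moreover have "\<forall>\<^sub>F z in at_right y. f z * (z - y) > 0"
          using np(2) r by eventually_elim simp
        ultimately show ?thesis using True by (simp add: eventually_at_split)
      qed
    qed
    then show ?thesis
      unfolding eq using Q
    proof (elim disjE, goal_cases)
      case 1
      from 1 have "\<forall>\<^sub>F z in at y. 0 < f z * (if y \<in> C then z - y else 1) * ?Q z"
        by eventually_elim simp
      then show ?case ..
    next
      case 2
      from 2 have "\<forall>\<^sub>F z in at y. f z * (if y \<in> C then z - y else 1) * ?Q z < 0"
        by eventually_elim (rule mult_pos_neg)
      then show ?case ..
    next
      case 3
      from 3 have "\<forall>\<^sub>F z in at y. f z * (if y \<in> C then z - y else 1) * ?Q z < 0"
        by eventually_elim (rule mult_neg_pos)
      then show ?case ..
    next
      case 4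
      from 4 have "\<forall>\<^sub>F z in at y. 0 < f z * (if y \<in> C then z - y else 1) * ?Q z"
        by eventually_elim (rule mult_neg_neg)
      then show ?case ..
    qed
  qed
  then have glob: "(\<forall>y. \<forall>\<^sub>F z in at y. 0 < ?g z) \<or> (\<forall>y. \<forall>\<^sub>F z in at y. ?g z < 0)"
    by (rule punctured_sign_global)
  \<comment> \<open>Continuity carries the sign from the punctured neighbourhoods to the points
    themselves, at the price of strictness.\<close>
  have lim: "(?g \<longlongrightarrow> ?g y) (at y)" for y
    using cont by (intro tendsto_intros) (simp add: continuous_on_def)
  from glob show thesis
  proof
    assume pos: "\<forall>y. \<forall>\<^sub>F z in at y. 0 < ?g z"
    have "\<forall>\<^sub>F z in at y. 0 \<le> ?g z" for y
      using pos[rule_format, of y] by (rule eventually_mono) simp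
    then have "0 \<le> ?g y" for y
      by (intro tendsto_lowerbound[OF lim]) auto
    then show thesis by (intro that[of C 1] C) auto
  next
    assume neg: "\<forall>y. \<forall>\<^sub>F z in at y. ?g z < 0"
    have "\<forall>\<^sub>F z in at y. ?g z \<le> 0" for y
      using neg[rule_format, of y] by (rule eventually_mono) simp
    then have "?g y \<le> 0" for y
      by (intro tendsto_upperbound[OF lim]) auto
    then show thesis by (intro that[of C "-1"] C) auto
  qed
qed

section \<open>Differentiation of bilateral Laplace transforms\<close>

text \<open>As \<open>\<bar>y\<bar> \<le> exp y + exp (- y)\<close>, the extra factor
  \<open>y\<close> is dominated by the integrands at \<open>x + 1\<close> and
  \<open>x - 1\<close>.\<close>

lemma laplace_moment_integrable:
  fixes w :: "real \<Rightarrow> real"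
  assumes int: "\<And>x. integrable lborel (\<lambda>y. exp (x * y) * w y)"
  shows "integrable lborel (\<lambda>y. exp (x * y) * (y * w y))"
proof -
  have [measurable]: "w \<in> borel_measurable lborel"
    using borel_measurable_integrable[OF int[of 0]] by simp
  let ?g = "\<lambda>y. \<bar>exp ((x + 1) * y) * w y\<bar> + \<bar>exp ((x - 1) * y) * w y\<bar>"
  have g: "integrable lborel ?g" using int by (intro Bochner_Integration.integrable_add integrable_abs)
  show ?thesis
  proof (rule Bochner_Integration.integrable_bound[OF g])
    show "AE y in lborel. norm (exp (x * y) * (y * w y)) \<le> norm (?g y)"
    proof (intro AE_I2)
      fix y :: real
      have "\<bar>y\<bar> \<le> exp y + exp (- y)"
        using exp_ge_add_one_self[of y] exp_ge_add_one_self[of "- y"]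
        by (smt (verit) exp_gt_zero)
      then have "(exp (x * y) * \<bar>w y\<bar>) * \<bar>y\<bar> \<le> (exp (x * y) * \<bar>w y\<bar>) * (exp y + exp (- y))"
        by (intro mult_left_mono) auto
      also have "\<dots> = ?g y"
        by (simp add: abs_mult exp_add exp_minus exp_diff algebra_simps divide_inverse)
      finally show "norm (exp (x * y) * (y * w y)) \<le> norm (?g y)"
        by (simp add: abs_mult mult_ac)
    qed
  qed simp
qed

text \<open>Serves to dominate the difference quotients of the exponential kernel.\<close>

lemma abs_exp_minus_one_le: "\<bar>exp t - 1\<bar> \<le> \<bar>t\<bar> * exp \<bar>t\<bar>" for t :: real
proof (cases "0 \<le> t")
  case True
  have "(1 - t) * exp t \<le> exp (- t) * exp t"
    using exp_ge_add_one_self[of "- t"] by (intro mult_right_mono) auto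
  then show ?thesis using True by (simp add: algebra_simps flip: exp_add)
next
  case False
  have "1 - exp t \<le> - t" using exp_ge_add_one_self[of t] by linarith
  also have "\<dots> \<le> - t * exp (- t)"
    using False mult_left_mono[of 1 "exp (- t)" "- t"] by simp
  finally show ?thesis using False by simp
qed

text \<open>Differentiation under the integral sign: for increments of size at most 1 the difference
  quotients are dominated by first-moment integrands at \<open>x + 1\<close> and
  \<open>x - 1\<close>.\<close>

lemma laplace_deriv:
  fixes w :: "real \<Rightarrow> real"
  assumes int: "\<And>x. integrable lborel (\<lambda>y. exp (x * y) * w y)"
  shows "((\<lambda>x. \<integral>y. exp (x * y) * w y \<partial>lborel) has_real_derivative
          (\<integral>y. exp (x * y) * (y * w y) \<partial>lborel)) (at x)"
proof -
  have [measurable]: "w \<in> borel_measurable lborel"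
    using borel_measurable_integrable[OF int[of 0]] by simp
  let ?L = "\<lambda>x. \<integral>y. exp (x * y) * w y \<partial>lborel"
  let ?D = "\<integral>y. exp (x * y) * (y * w y) \<partial>lborel"
  let ?q = "\<lambda>h y. exp (x * y) * w y * ((exp (h * y) - 1) / h)"
  let ?b = "\<lambda>y. \<bar>exp ((x + 1) * y) * (y * w y)\<bar> + \<bar>exp ((x - 1) * y) * (y * w y)\<bar>"
  have b: "integrable lborel ?b"
    using laplace_moment_integrable[OF int]
    by (intro Bochner_Integration.integrable_add integrable_abs)
  have bound: "\<bar>?q h y\<bar> \<le> ?b y" if h: "h \<noteq> 0" "\<bar>h\<bar> \<le> 1" for h y
  proof -
    have "\<bar>(exp (h * y) - 1) / h\<bar> \<le> \<bar>h * y\<bar> * exp \<bar>h * y\<bar> / \<bar>h\<bar>"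
      unfolding abs_divide by (intro divide_right_mono abs_exp_minus_one_le) simp
    also have "\<dots> = \<bar>y\<bar> * exp \<bar>h * y\<bar>" using h by (simp add: abs_mult)
    also have "exp \<bar>h * y\<bar> \<le> exp \<bar>y\<bar>"
      using h by (simp add: abs_mult mult_left_le_one_le)
    also have "exp \<bar>y\<bar> \<le> exp y + exp (- y)" by (simp add: abs_if)
    finally have "\<bar>(exp (h * y) - 1) / h\<bar> \<le> \<bar>y\<bar> * (exp y + exp (- y))"
      by (simp add: mult_left_mono)
    then have "\<bar>?q h y\<bar> \<le> (exp (x * y) * \<bar>w y\<bar>) * (\<bar>y\<bar> * (exp y + exp (- y)))"
      unfolding abs_mult by (intro mult_mono) auto
    also have "\<dots> = ?b y"
      by (simp add: abs_mult exp_add exp_minus exp_diff algebra_simps divide_inverse)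
    finally show ?thesis .
  qed
  have "((\<lambda>h. (?L (x + h) - ?L x) / h) \<longlongrightarrow> ?D) (at 0)"
    unfolding tendsto_at_iff_sequentially comp_def
  proof (intro allI impI)
    fix X :: "nat \<Rightarrow> real"
    assume X: "\<forall>i. X i \<in> UNIV - {0}" "X \<longlonglongrightarrow> 0"
    have quot: "(?L (x + h) - ?L x) / h = (\<integral>y. ?q h y \<partial>lborel)" for h
    proof -
      have "?L (x + h) - ?L x = (\<integral>y. exp ((x + h) * y) * w y - exp (x * y) * w y \<partial>lborel)"
        using int by (subst Bochner_Integration.integral_diff) auto
      then have "(?L (x + h) - ?L x) / h
          = (\<integral>y. (exp ((x + h) * y) * w y - exp (x * y) * w y) / h \<partial>lborel)"
        by simp
      also have "\<dots> = (\<integral>y. ?q h y \<partial>lborel)"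
        by (intro Bochner_Integration.integral_cong) (auto simp: exp_add algebra_simps diff_divide_distrib)
      finally show ?thesis .
    qed
    \<comment> \<open>The domination needs \<open>\<bar>h\<bar> \<le> 1\<close>, which holds only
      from some index on, so the sequence is shifted by \<open>N\<close> before passing to the
      limit.\<close>
    obtain N where N: "\<And>n. N \<le> n \<Longrightarrow> \<bar>X n\<bar> \<le> 1"
      using LIMSEQ_D[OF X(2), of 1] by (auto intro: less_imp_le)
    have "(\<lambda>n. \<integral>y. ?q (X (n + N)) y \<partial>lborel) \<longlonglongrightarrow> ?D"
    proof (rule integral_dominated_convergence[OF _ _ b])
      show "AE y in lborel. (\<lambda>n. ?q (X (n + N)) y) \<longlonglongrightarrow> exp (x * y) * (y * w y)"
      proof (intro AE_I2)
        fix y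
        have "((\<lambda>h. exp (h * y)) has_real_derivative y) (at 0)"
          by (auto intro!: derivative_eq_intros)
        then have "((\<lambda>h. (exp (h * y) - 1) / h) \<longlongrightarrow> y) (at 0)"
          by (simp add: DERIV_def)
        then have "(\<lambda>n. (exp (X n * y) - 1) / X n) \<longlonglongrightarrow> y"
          using X unfolding tendsto_at_iff_sequentially comp_def by blast
        then have "(\<lambda>n. ?q (X n) y) \<longlonglongrightarrow> exp (x * y) * w y * y"
          by (intro tendsto_intros)
        then show "(\<lambda>n. ?q (X (n + N)) y) \<longlonglongrightarrow> exp (x * y) * (y * w y)"
          using LIMSEQ_ignore_initial_segment[of "\<lambda>n. ?q (X n) y" _ N] by (simp add: mult_ac)
      qed
      show "AE y in lborel. norm (?q (X (n + N)) y) \<le> ?b y" for n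
        using bound[of "X (n + N)"] N[of "n + N"] X(1) by auto
    qed simp_all
    then have "(\<lambda>n. \<integral>y. ?q (X n) y \<partial>lborel) \<longlonglongrightarrow> ?D"
      by (rule LIMSEQ_offset)
    then show "(\<lambda>n. (?L (x + X n) - ?L x) / X n) \<longlonglongrightarrow> ?D" by (simp only: quot)
  qed
  then show ?thesis by (simp add: DERIV_def)
qed

section \<open>Descartes' rule of signs for Laplace transforms\<close>

text \<open>Induction on the possible sign changes, over all weights at once because each step
  replaces \<open>w\<close> by \<open>(y - c) * w y\<close>. With none left, the integrand is
  nonnegative and not almost everywhere zero, so the transform has no zero.\<close>

lemma laplace_zeros_prod:
  fixes w :: "real \<Rightarrow> real"
  assumes "finite C"
    and "\<And>x. integrable lborel (\<lambda>y. exp (x * y) * w y)"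
    and "\<And>y. 0 \<le> w y * (\<Prod>c\<in>C. y - c)"
    and "\<not> (AE y in lborel. w y = 0)"
  shows "finite {x. (\<integral>y. exp (x * y) * w y \<partial>lborel) = 0} \<and>
         card {x. (\<integral>y. exp (x * y) * w y \<partial>lborel) = 0} \<le> card C"
  using assms
proof (induction C arbitrary: w rule: finite_induct)
  case empty
  have "(\<integral>y. exp (x * y) * w y \<partial>lborel) \<noteq> 0" for x
    using empty integral_nonneg_eq_0_iff_AE[OF empty(1), of x] by simp
  then show ?case by simp
next
  case (insert c C)
  let ?L = "\<lambda>x. \<integral>y. exp (x * y) * w y \<partial>lborel"
  let ?w' = "\<lambda>y. (y - c) * w y"
  let ?L' = "\<lambda>x. \<integral>y. exp (x * y) * ?w' y \<partial>lborel"
  have int': "integrable lborel (\<lambda>y. exp (x * y) * ?w' y)"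
    and L': "?L' x = (\<integral>y. exp (x * y) * (y * w y) \<partial>lborel) - c * ?L x" for x
  proof -
    have eq: "(\<lambda>y. exp (x * y) * ?w' y)
      = (\<lambda>y. exp (x * y) * (y * w y) - c * (exp (x * y) * w y))"
      by (simp add: fun_eq_iff algebra_simps)
    show "integrable lborel (\<lambda>y. exp (x * y) * ?w' y)"
      "?L' x = (\<integral>y. exp (x * y) * (y * w y) \<partial>lborel) - c * ?L x"
      unfolding eq using laplace_moment_integrable[OF insert.prems(1)] insert.prems(1)
      by (auto simp: Bochner_Integration.integral_diff)
  qed
  have "\<not> (AE y in lborel. ?w' y = 0)"
  proof
    assume "AE y in lborel. ?w' y = 0"
    with AE_lborel_singleton[of c] have "AE y in lborel. w y = 0" by eventually_elim simp
    then show False using insert.prems(3) by simp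
  qed
  moreover have "0 \<le> ?w' y * (\<Prod>c\<in>C. y - c)" for y
    using insert.prems(2)[of y] insert.hyps by (simp add: mult_ac)
  ultimately have IH: "finite {x. ?L' x = 0} \<and> card {x. ?L' x = 0} \<le> card C"
    using insert.IH[of ?w'] int' by simp
  \<comment> \<open>The factor \<open>exp (- c * x)\<close> makes differentiation multiply the weight by \<open>y - c\<close>, which
    removes one sign change, while Rolle's theorem loses at most one zero.\<close>
  have "((\<lambda>x. exp (- c * x) * ?L x) has_real_derivative exp (- c * x) * ?L' x) (at x)" for x
    unfolding L'
    by (rule derivative_eq_intros laplace_deriv[OF insert.prems(1)] refl)+ (simp add: algebra_simps)
  from rolle_zeros_finite[OF this] IH insert.hyps show ?case by simp
qed

text \<open>The sign changes of \<open>w\<close> are among its zeros, and a finite zero set is null,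
  so \<open>w\<close> is not almost everywhere zero. The sign \<open>e\<close> does not affect the
  zeros of the transform.\<close>

lemma laplace_zeros:
  fixes w :: "real \<Rightarrow> real"
  assumes cont: "continuous_on UNIV w" and fin: "finite {y. w y = 0}"
    and int: "\<And>x. integrable lborel (\<lambda>y. exp (x * y) * w y)"
  shows "finite {x. (\<integral>y. exp (x * y) * w y \<partial>lborel) = 0} \<and>
         card {x. (\<integral>y. exp (x * y) * w y \<partial>lborel) = 0} \<le> card {y. w y = 0}"
proof -
  obtain C e where C: "C \<subseteq> {y. w y = 0}" and e: "e = 1 \<or> e = (- 1 :: real)"
    and sgn: "\<And>y. 0 \<le> e * w y * (\<Prod>c\<in>C. y - c)"
    using sign_changes[OF cont fin] by blast
  have eq: "(\<lambda>y. exp (x * y) * (e * w y)) = (\<lambda>y. e * (exp (x * y) * w y))" for x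
    by (simp add: fun_eq_iff)
  have "\<not> (AE y in lborel. e * w y = 0)"
  proof
    assume "AE y in lborel. e * w y = 0"
    moreover have "AE y in lborel. y \<notin> {y. w y = 0}"
      using finite_imp_null_set_lborel[OF fin] by (rule AE_not_in)
    ultimately have "AE y in (lborel :: real measure). False"
      by eventually_elim (use e in auto)
    then show False by (simp add: ae_filter_eq_bot_iff flip: trivial_limit_def)
  qed
  then have "finite {x. (\<integral>y. exp (x * y) * (e * w y) \<partial>lborel) = 0} \<and>
         card {x. (\<integral>y. exp (x * y) * (e * w y) \<partial>lborel) = 0} \<le> card C"
    using C fin finite_subset int sgn by (intro laplace_zeros_prod) (auto simp: eq)
  moreover have "{x. (\<integral>y. exp (x * y) * (e * w y) \<partial>lborel) = 0}
    = {x. (\<integral>y. exp (x * y) * w y \<partial>lborel) = 0}"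
    unfolding eq using e by auto
  ultimately show ?thesis using card_mono[OF fin C] by simp
qed

subsection \<open>Gaussian smoothing of the logistic function\<close>

lemma logistic_pos: "0 < logistic t"
  and logistic_less_1: "logistic t < 1"
  by (auto simp: logistic_def add_pos_pos)

lemma logistic_minus: "logistic (- t) = 1 - logistic t"
proof -
  have "inverse e / (1 + inverse e) = 1 - e / (1 + e)" if "0 < e" for e :: real
    using that by (simp add: divide_simps)
  then show ?thesis by (simp add: logistic_def exp_minus)
qed

text \<open>The odds \<open>s / (1 - s)\<close> equal \<open>exp t\<close>. This form is linear in
  \<open>s\<close>, so for a smoothed value \<open>s\<close> it remains a statement about one
  integral.\<close>

lemma logistic_eq_iff_odds: "s = logistic t \<longleftrightarrow> s = exp t * (1 - s)"
proof -
  have "s = e / (1 + e) \<longleftrightarrow> s = e * (1 - s)" if "0 < e" for e :: real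
    using that by (simp add: divide_simps) (simp add: algebra_simps)
  then show ?thesis by (simp add: logistic_def)
qed

lemma has_real_derivative_logistic [derivative_intros]:
  assumes "(g has_real_derivative g') (at x within S)"
  shows "((\<lambda>x. logistic (g x)) has_real_derivative logistic (g x) * (1 - logistic (g x)) * g') (at x within S)"
proof -
  have "1 + exp t \<noteq> 0" for t :: real using exp_gt_zero[of t] by linarith
  then have "(logistic has_real_derivative logistic t * (1 - logistic t)) (at t)" for t
    unfolding logistic_def[abs_def]
    by (auto intro!: derivative_eq_intros simp: power2_eq_square divide_simps) (simp add: algebra_simps)
  from DERIV_chain2[OF this assms] show ?thesis .
qed

lemma continuous_on_logistic [continuous_intros]:
  "continuous_on S g \<Longrightarrow> continuous_on S (\<lambda>x. logistic (g x))"
proof -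
  have "1 + exp t \<noteq> 0" for t :: real using exp_gt_zero[of t] by linarith
  then show "continuous_on S g \<Longrightarrow> continuous_on S (\<lambda>x. logistic (g x))"
    unfolding logistic_def by (intro continuous_intros) auto
qed

lemma borel_measurable_logistic [measurable]: "logistic \<in> borel_measurable borel"
  unfolding logistic_def[abs_def] by measurable

lemma logistic_eq_iff [simp]: "logistic s = logistic t \<longleftrightarrow> s = t"
proof -
  have "exp t = logistic t / (1 - logistic t)" for t
    using logistic_less_1[of t] logistic_eq_iff_odds[of "logistic t" t] by (simp add: field_simps)
  then show ?thesis by (metis exp_inj_iff)
qed

text \<open>The difference of the two sides factors into differences of logistic values, to which
  injectivity applies.\<close>

lemma logistic_deriv_eq_iff:
  "logistic s * (1 - logistic s) = logistic t * (1 - logistic t) \<longleftrightarrow> s = t \<or> s = - t"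
proof -
  have "logistic s * (1 - logistic s) - logistic t * (1 - logistic t)
      = (logistic s - logistic t) * (logistic (- t) - logistic s)"
    unfolding logistic_minus by (simp add: algebra_simps)
  then have "logistic s * (1 - logistic s) = logistic t * (1 - logistic t)
      \<longleftrightarrow> (logistic s - logistic t) * (logistic (- t) - logistic s) = 0" by linarith
  then show ?thesis by auto
qed

section \<open>Gaussian smoothing as a Laplace transform\<close>

lemma prob_space_normal_law: "0 \<le> v \<Longrightarrow> prob_space (normal_law v)"
  unfolding normal_law_def by (auto intro: prob_space_return prob_space_normal_density)

lemma sets_normal_law [simp, measurable_cong]: "sets (normal_law v) = sets borel"
  unfolding normal_law_def by auto

lemma space_normal_law [simp]: "space (normal_law v) = UNIV"
  unfolding normal_law_def by auto

lemma integral_normal_law_0: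
  "f \<in> borel_measurable borel \<Longrightarrow> (\<integral>u. f u \<partial>normal_law 0) = (f 0 :: real)"
  unfolding normal_law_def by (simp add: integral_return)

text \<open>Expanding the square: translating the Gaussian kernel is the same as tilting it
  exponentially. This links smoothing to Laplace transforms.\<close>

lemma normal_density_shift:
  assumes "0 < v"
  shows "normal_density 0 (sqrt v) (y - d)
    = exp (- d\<^sup>2 / (2 * v)) * (exp (d / v * y) * normal_density 0 (sqrt v) y)"
proof -
  have "- ((y - d)\<^sup>2) / (2 * v) = - d\<^sup>2 / (2 * v) + (d / v * y + (- y\<^sup>2) / (2 * v))"
    using assms by (simp add: field_simps power2_eq_square)
  then show ?thesis using assms
    unfolding normal_density_def by (simp flip: exp_add)
qed

lemma integrable_exp_normal_density:
  fixes f :: "real \<Rightarrow> real"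
  assumes v: "0 < v" and [measurable]: "f \<in> borel_measurable borel" and B: "\<And>y. \<bar>f y\<bar> \<le> B"
  shows "integrable lborel (\<lambda>y. exp (t * y) * (normal_density 0 (sqrt v) y * f y))"
proof -
  \<comment> \<open>The shift formula with \<open>d = v * t\<close>, read backwards.\<close>
  have eq: "exp (t * y) * normal_density 0 (sqrt v) y
      = exp ((v * t)\<^sup>2 / (2 * v)) * normal_density 0 (sqrt v) (y - v * t)" for y
    using v by (simp add: normal_density_shift[OF v] flip: mult.assoc exp_add)
  have "integrable lborel (\<lambda>y. normal_density 0 (sqrt v) (y - v * t))"
    using lborel_integrable_real_affine[of "normal_density 0 (sqrt v)" 1 "- v * t"] v by simp
  then have "integrable lborel (\<lambda>y. exp (t * y) * normal_density 0 (sqrt v) y)"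
    unfolding eq by simp
  then have "integrable lborel (\<lambda>y. B * (exp (t * y) * normal_density 0 (sqrt v) y))" by simp
  then show ?thesis
  proof (rule Bochner_Integration.integrable_bound)
    show "AE y in lborel. norm (exp (t * y) * (normal_density 0 (sqrt v) y * f y))
        \<le> norm (B * (exp (t * y) * normal_density 0 (sqrt v) y))"
      using B order_trans[OF abs_ge_zero B] by (auto simp: abs_mult mult_ac intro!: mult_right_mono)
  qed simp
qed

text \<open>After substituting \<open>y = x + u\<close>, the shifted kernel splits off a
  nonvanishing factor, so zeros of the smoothing are zeros of a Laplace transform at
  \<open>x / v\<close>.\<close>

lemma integral_normal_law_shift:
  fixes f :: "real \<Rightarrow> real"
  assumes v: "0 < v" and [measurable]: "f \<in> borel_measurable borel"
  shows "(\<integral>u. f (x + u) \<partial>normal_law v)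
    = exp (- x\<^sup>2 / (2 * v)) * (\<integral>y. exp (x / v * y) * (normal_density 0 (sqrt v) y * f y) \<partial>lborel)"
proof -
  have "(\<integral>u. f (x + u) \<partial>normal_law v) = (\<integral>u. normal_density 0 (sqrt v) u * f (x + u) \<partial>lborel)"
    using v unfolding normal_law_def by (simp add: integral_density)
  also have "\<dots> = (\<integral>y. normal_density 0 (sqrt v) (y - x) * f y \<partial>lborel)"
    using lborel_integral_real_affine[of 1 "\<lambda>y. normal_density 0 (sqrt v) (y - x) * f y" x] by simp
  also have "\<dots> = (\<integral>y. exp (- x\<^sup>2 / (2 * v)) *
      (exp (x / v * y) * (normal_density 0 (sqrt v) y * f y)) \<partial>lborel)"
    by (simp only: normal_density_shift[OF v] mult_ac)
  finally show ?thesis by simp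
qed

text \<open>Continuity is inherited from the differentiability of the Laplace transform.\<close>

lemma continuous_on_normal_law_shift:
  fixes f :: "real \<Rightarrow> real"
  assumes v: "0 < v" and f: "f \<in> borel_measurable borel" and B: "\<And>y. \<bar>f y\<bar> \<le> B"
  shows "continuous_on S (\<lambda>x. \<integral>u. f (x + u) \<partial>normal_law v)"
proof -
  let ?L = "\<lambda>t. \<integral>y. exp (t * y) * (normal_density 0 (sqrt v) y * f y) \<partial>lborel"
  have "continuous_on UNIV ?L"
    by (rule DERIV_continuous_on)
      (rule DERIV_subset[OF laplace_deriv[OF integrable_exp_normal_density[OF v f B]]], simp)
  then have "continuous_on S (\<lambda>x. ?L (x / v))"
    by (rule continuous_on_compose2) (use v in \<open>auto intro!: continuous_intros\<close>)
  then show ?thesis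
    unfolding integral_normal_law_shift[OF v f] using v by (intro continuous_intros) auto
qed

text \<open>Variation-diminishing property of the Gaussian kernel: the positive density adds no
  zeros to the weight, and \<open>t \<mapsto> v * t\<close> carries zeros of the transform to zeros
  of the smoothing.\<close>

lemma normal_smoothing_zeros:
  fixes f :: "real \<Rightarrow> real"
  assumes v: "0 \<le> v" and cont: "continuous_on UNIV f" and B: "\<And>y. \<bar>f y\<bar> \<le> B"
    and fin: "finite {y. f y = 0}"
  shows "finite {x. (\<integral>u. f (x + u) \<partial>normal_law v) = 0} \<and>
         card {x. (\<integral>u. f (x + u) \<partial>normal_law v) = 0} \<le> card {y. f y = 0}"
proof (cases "v = 0")
  case True
  have [measurable]: "f \<in> borel_measurable borel"
    using cont by (rule borel_measurable_continuous_onI)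
  show ?thesis using True fin by (simp add: integral_normal_law_0)
next
  case False
  with v have v: "0 < v" by simp
  have meas: "f \<in> borel_measurable borel"
    using cont by (rule borel_measurable_continuous_onI)
  let ?w = "\<lambda>y. normal_density 0 (sqrt v) y * f y"
  let ?Z = "{t. (\<integral>y. exp (t * y) * ?w y \<partial>lborel) = 0}"
  have "normal_density 0 (sqrt v) y \<noteq> 0" for y
    using v normal_density_pos[of "sqrt v" 0 y] by simp
  then have zeros: "{y. ?w y = 0} = {y. f y = 0}" by simp
  then have fin': "finite {y. ?w y = 0}" using fin by simp
  have cont': "continuous_on UNIV ?w"
    unfolding normal_density_def using v by (intro continuous_intros cont) auto
  have Z: "finite ?Z \<and> card ?Z \<le> card {y. f y = 0}"
    using laplace_zeros[OF cont' fin' integrable_exp_normal_density[OF v meas B]]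
    unfolding zeros .
  have image: "{x. (\<integral>u. f (x + u) \<partial>normal_law v) = 0} = (\<lambda>t. v * t) ` ?Z"
  proof (intro set_eqI iffI)
    fix x assume "x \<in> {x. (\<integral>u. f (x + u) \<partial>normal_law v) = 0}"
    then have "x / v \<in> ?Z" by (simp add: integral_normal_law_shift[OF v meas])
    then show "x \<in> (\<lambda>t. v * t) ` ?Z" using v by (intro image_eqI[of _ _ "x / v"]) auto
  next
    fix x assume "x \<in> (\<lambda>t. v * t) ` ?Z"
    then show "x \<in> {x. (\<integral>u. f (x + u) \<partial>normal_law v) = 0}"
      using v by (auto simp: integral_normal_law_shift[OF v meas])
  qed
  show ?thesis
    unfolding image using Z by (blast intro: card_image_le order_trans)
qed

text \<open>Semigroup property: the law of variance \<open>w\<close> is the convolution of those of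
  variances \<open>v\<close> and \<open>w - v\<close>; Fubini's theorem then iterates the
  integral.\<close>

lemma integral_normal_law_add:
  fixes f :: "real \<Rightarrow> real"
  assumes "0 \<le> v" "v \<le> w" and [measurable]: "f \<in> borel_measurable borel" and B: "\<And>y. \<bar>f y\<bar> \<le> B"
  shows "(\<integral>u. f u \<partial>normal_law w) = (\<integral>s. (\<integral>t. f (s + t) \<partial>normal_law (w - v)) \<partial>normal_law v)"
proof -
  \<comment> \<open>The convolution formula is for densities; when \<open>v\<close> or
    \<open>w - v\<close> is zero, the corresponding integral is evaluation at 0.\<close>
  consider "v = 0" | "v = w" | "0 < v" "v < w" using assms(1,2) by linarith
  then show ?thesis
  proof cases
    case 1
    interpret prob_space "normal_law w" using assms prob_space_normal_law by simp
    have "(\<lambda>s. \<integral>t. f (s + t) \<partial>normal_law w) \<in> borel_measurable borel" by measurable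
    then show ?thesis using 1 by (simp add: integral_normal_law_0)
  next
    case 2
    then show ?thesis by (simp add: integral_normal_law_0)
  next
    case 3
    let ?p = "normal_density 0 (sqrt v)" and ?q = "normal_density 0 (sqrt (w - v))"
    interpret V: prob_space "normal_law v" using assms prob_space_normal_law by simp
    interpret W: prob_space "normal_law (w - v)" using assms prob_space_normal_law by simp
    interpret P: pair_prob_space "normal_law v" "normal_law (w - v)" ..
    have "normal_law v \<star> normal_law (w - v)
        = density lborel (\<lambda>x. \<integral>\<^sup>+y. ennreal (?p (x - y)) * ennreal (?q y) \<partial>lborel)"
      using 3 V.finite_measure_axioms W.finite_measure_axioms unfolding normal_law_def
      by (simp add: convolution_density)
    also have "\<dots> = normal_law w"
      using 3 fun_cong[OF conv_normal_density_zero_mean[of "sqrt v" "sqrt (w - v)"]]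
      by (simp add: normal_law_def ennreal_mult'')
    finally have "normal_law w = distr (normal_law v \<Otimes>\<^sub>M normal_law (w - v)) borel (\<lambda>(s, t). s + t)"
      by (simp add: convolution_def)
    then have "(\<integral>u. f u \<partial>normal_law w)
        = (\<integral>z. f (fst z + snd z) \<partial>(normal_law v \<Otimes>\<^sub>M normal_law (w - v)))"
      by (simp add: integral_distr case_prod_beta')
    also have "\<dots> = (\<integral>s. (\<integral>t. f (s + t) \<partial>normal_law (w - v)) \<partial>normal_law v)"
      using B by (subst P.integral_fst'[symmetric])
        (auto intro!: P.integrable_const_bound[where B = B])
    finally show ?thesis .
  qed
qed

lemma abs_logistic_le: "\<bar>logistic t\<bar> \<le> 1"
  using logistic_pos[of t] logistic_less_1[of t] by linarith

section \<open>Zero counts for differences of smoothed logistic curves\<close>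

lemma exp_mult_logistic_minus_eq_iff: "exp s * logistic (- t) = logistic u \<longleftrightarrow> ln (logistic u) - ln (logistic (- t)) - s = 0"
proof -
  have "exp s * logistic (- t) = logistic u \<longleftrightarrow> ln (exp s * logistic (- t)) = ln (logistic u)"
    by (subst ln_inj_iff) (auto simp: logistic_pos)
  also have "\<dots> \<longleftrightarrow> ln (logistic u) - ln (logistic (- t)) - s = 0"
    by (subst ln_mult_pos) (auto simp: logistic_pos)
  finally show ?thesis .
qed

text \<open>The second derivative has a single zero, and each of two applications of Rolle's theorem
  adds at most one: hence three.\<close>

lemma log_logistic_ratio_zeros:
  fixes b0 b1 d k c :: real
  assumes "b1 \<noteq> 0" "d \<noteq> 0"
  defines "\<psi> \<equiv> \<lambda>z. ln (logistic (b0 + b1 * z)) - ln (logistic (- (b0 + b1 * (z - d)))) - (c + k * z)"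
  shows "finite {z. \<psi> z = 0} \<and> card {z. \<psi> z = 0} \<le> 3"
proof -
  let ?p = "\<lambda>z. logistic (b0 + b1 * z)" and ?q = "\<lambda>z. logistic (b0 + b1 * (z - d))"
  \<comment> \<open>The derivative of \<open>ln (logistic t)\<close> is
    \<open>1 - logistic t\<close>, that of \<open>ln (logistic (- t))\<close> is
    \<open>- logistic t\<close>; the affine term drops out of the second derivative.\<close>
  let ?\<psi>' = "\<lambda>z. b1 * (1 - ?p z + ?q z) - k"
  let ?\<psi>'' = "\<lambda>z. b1 * (?q z * (1 - ?q z) * b1 - ?p z * (1 - ?p z) * b1)"
  have "?\<psi>'' z = 0 \<longleftrightarrow> z = d / 2 - b0 / b1" for z
  proof -
    have "?\<psi>'' z = 0 \<longleftrightarrow> ?q z * (1 - ?q z) = ?p z * (1 - ?p z)" using assms by auto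
    \<comment> \<open>Equal arguments are excluded by \<open>b1 * d \<noteq> 0\<close>, which leaves
      opposite ones.\<close>
    also have "\<dots> \<longleftrightarrow> b0 + b1 * (z - d) = - (b0 + b1 * z)"
      unfolding logistic_deriv_eq_iff using assms by auto
    also have "\<dots> \<longleftrightarrow> z = d / 2 - b0 / b1" using assms by (auto simp: field_simps)
    finally show ?thesis .
  qed
  then have 2: "{z. ?\<psi>'' z = 0} = {d / 2 - b0 / b1}" by blast
  have "(?\<psi>' has_real_derivative ?\<psi>'' z) (at z)" for z
    by (auto intro!: derivative_eq_intros)
  from rolle_zeros_finite[OF this] have 1: "finite {z. ?\<psi>' z = 0}" "card {z. ?\<psi>' z = 0} \<le> 2"
    unfolding 2 by auto
  have "(\<psi> has_real_derivative ?\<psi>' z) (at z)" for z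
  proof -
    have pos: "0 < ?p z" "0 < 1 - ?q z"
      using logistic_pos logistic_less_1 by simp_all
    have "(\<psi> has_real_derivative
        ?p z * (1 - ?p z) * b1 / ?p z - - (?q z * (1 - ?q z) * b1) / (1 - ?q z) - k) (at z)"
      unfolding \<psi>_def logistic_minus using pos by (auto intro!: derivative_eq_intros)
    also have "?p z * (1 - ?p z) * b1 / ?p z = (1 - ?p z) * b1" using pos by simp
    also have "- (?q z * (1 - ?q z) * b1) / (1 - ?q z) = - (?q z * b1)" using pos by simp
    also have "(1 - ?p z) * b1 - - (?q z * b1) - k = ?\<psi>' z" by (simp add: algebra_simps)
    finally show ?thesis .
  qed
  from rolle_zeros_finite[OF this] 1 show ?thesis by simp
qed

text \<open>The bound three is that of \<open>log_logistic_ratio_zeros\<close>, carried over by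
  Descartes' rule. Positive \<open>v\<close> and nonzero \<open>a1\<close> make the shift nonzero,
  as that lemma demands.\<close>

lemma logistic_minus_smoothed_zeros:
  fixes a0 a1 b0 b1 v :: real
  assumes v: "0 < v" and "a1 \<noteq> 0" "b1 \<noteq> 0"
  defines "Z \<equiv> {x. logistic (a0 + a1 * x) - (\<integral>u. logistic (b0 + b1 * (x + u)) \<partial>normal_law v) = 0}"
  shows "finite Z \<and> card Z \<le> 3"
proof -
  define d where "d = a1 * v"
  let ?\<phi> = "normal_density 0 (sqrt v)"
  let ?p = "\<lambda>z. logistic (b0 + b1 * z)" and ?q = "\<lambda>z. logistic (- (b0 + b1 * (z - d)))"
  \<comment> \<open>Multiplied by \<open>1 + exp (a0 + a1 * x)\<close>, the difference defining \<open>Z\<close> is a Gaussian integral in which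
    the factor \<open>exp (a1 * x)\<close> amounts to shifting the kernel by \<open>d\<close>.  What remains is, up to a
    nonzero factor, the Laplace transform of \<open>?w\<close> at \<open>x / v\<close>.\<close>
  let ?w = "\<lambda>z. ?\<phi> z * ?p z - exp a0 * (?\<phi> (z - d) * ?q z)"
  let ?L = "\<lambda>t. \<integral>z. exp (t * z) * ?w z \<partial>lborel"
  have \<phi>_pos: "0 < ?\<phi> z" for z using v by (intro normal_density_pos) simp
  have "d / v = a1" using v by (simp add: d_def)
  then have \<phi>_d: "?\<phi> (z - d) = exp (- d\<^sup>2 / (2 * v)) * (exp (a1 * z) * ?\<phi> z)" for z
    using normal_density_shift[OF v, of z d] by (simp only:)
  \<comment> \<open>The two kernels differ by the exponential of an affine function of
    \<open>z\<close>; cancelling the positive \<open>?\<phi> z\<close> leaves a ratio of logistic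
    functions.\<close>
  have "?w z = 0 \<longleftrightarrow> exp (a0 + - d\<^sup>2 / (2 * v) + a1 * z) * ?q z = ?p z" for z
  proof -
    have "?w z = ?\<phi> z * (?p z - exp (a0 + - d\<^sup>2 / (2 * v) + a1 * z) * ?q z)"
      unfolding \<phi>_d exp_add by (simp only: right_diff_distrib mult_ac)
    then show ?thesis using \<phi>_pos[of z] by (simp only: mult_eq_0_iff) auto
  qed
  then have "{z. ?w z = 0} = {z. ln (?p z) - ln (?q z) - (a0 + - d\<^sup>2 / (2 * v) + a1 * z) = 0}"
    by (simp only: exp_mult_logistic_minus_eq_iff)
  moreover have "d \<noteq> 0" using assms by (simp add: d_def)
  ultimately have zeros: "finite {z. ?w z = 0}" "card {z. ?w z = 0} \<le> 3"
    using log_logistic_ratio_zeros[OF \<open>b1 \<noteq> 0\<close>] by simp_all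
  have cont: "continuous_on UNIV ?w"
    unfolding normal_density_def using v by (intro continuous_intros) auto
  have p: "integrable lborel (\<lambda>z. exp (t * z) * (?\<phi> z * ?p z))" for t
    by (rule integrable_exp_normal_density[OF v _ abs_logistic_le]) measurable
  have q: "integrable lborel (\<lambda>z. exp (t * z) * (exp a0 * (?\<phi> (z - d) * ?q z)))" for t
  proof -
    have "integrable lborel (\<lambda>z. exp ((t + a1) * z) * (?\<phi> z * ?q z))"
      by (rule integrable_exp_normal_density[OF v _ abs_logistic_le]) measurable
    then have "integrable lborel (\<lambda>z. exp a0 * exp (- d\<^sup>2 / (2 * v)) * (exp ((t + a1) * z) * (?\<phi> z * ?q z)))"
      by simp
    also have "(\<lambda>z. exp a0 * exp (- d\<^sup>2 / (2 * v)) * (exp ((t + a1) * z) * (?\<phi> z * ?q z)))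
      = (\<lambda>z. exp (t * z) * (exp a0 * (?\<phi> (z - d) * ?q z)))"
      unfolding \<phi>_d distrib_right exp_add by (simp only: mult_ac)
    finally show ?thesis .
  qed
  have int: "integrable lborel (\<lambda>z. exp (t * z) * ?w z)" for t
    using Bochner_Integration.integrable_diff[OF p q] by (simp add: right_diff_distrib)
  \<comment> \<open>The right-hand side is the odds form of
    \<open>S = logistic (a0 + a1 * x)\<close>.\<close>
  have L: "exp (- x\<^sup>2 / (2 * v)) * ?L (x / v) = S - exp (a0 + a1 * x) * (1 - S)"
    if S: "S = (\<integral>u. logistic (b0 + b1 * (x + u)) \<partial>normal_law v)" for x S
  proof -
    interpret prob_space "normal_law v" using v prob_space_normal_law by simp
    have "integrable (normal_law v) (\<lambda>u. logistic (b0 + b1 * (x + u)))"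
      by (rule integrable_const_bound[where B = 1]) (auto simp: abs_logistic_le)
    then have S': "1 - S = (\<integral>u. logistic (- (b0 + b1 * (x + u))) \<partial>normal_law v)"
      unfolding S logistic_minus using prob_space by simp
    \<comment> \<open>Substituting \<open>z = d + y\<close> moves the shift from the kernel into the
      exponent, where \<open>x / v * d = a1 * x\<close>.\<close>
    have "(\<integral>z. exp (x / v * z) * (exp a0 * (?\<phi> (z - d) * ?q z)) \<partial>lborel)
        = (\<integral>y. exp (x / v * (d + y)) * (exp a0 * (?\<phi> y * logistic (- (b0 + b1 * y)))) \<partial>lborel)"
      using lborel_integral_real_affine[of 1 "\<lambda>z. exp (x / v * z) * (exp a0 * (?\<phi> (z - d) * ?q z))" d]
      by simp
    also have "\<dots> = (\<integral>y. exp (a0 + a1 * x) *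
        (exp (x / v * y) * (?\<phi> y * logistic (- (b0 + b1 * y)))) \<partial>lborel)"
      using v by (intro Bochner_Integration.integral_cong)
        (simp_all add: d_def distrib_left exp_add mult_ac)
    finally have "exp (- x\<^sup>2 / (2 * v)) *
        (\<integral>z. exp (x / v * z) * (exp a0 * (?\<phi> (z - d) * ?q z)) \<partial>lborel) = exp (a0 + a1 * x) * (1 - S)"
      unfolding S' by (subst integral_normal_law_shift[OF v, of "\<lambda>y. logistic (- (b0 + b1 * y))"]) auto
    moreover have "exp (- x\<^sup>2 / (2 * v)) * (\<integral>z. exp (x / v * z) * (?\<phi> z * ?p z) \<partial>lborel) = S"
      unfolding S by (subst integral_normal_law_shift[OF v, of ?p]) auto
    moreover have "?L (x / v) = (\<integral>z. exp (x / v * z) * (?\<phi> z * ?p z) \<partial>lborel)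
        - (\<integral>z. exp (x / v * z) * (exp a0 * (?\<phi> (z - d) * ?q z)) \<partial>lborel)"
      using Bochner_Integration.integral_diff[OF p q, of "x / v" "x / v"] by (simp add: right_diff_distrib)
    ultimately show ?thesis by (simp add: right_diff_distrib)
  qed
  have "x \<in> Z \<longleftrightarrow> ?L (x / v) = 0" for x
  proof -
    define S where "S = (\<integral>u. logistic (b0 + b1 * (x + u)) \<partial>normal_law v)"
    have "x \<in> Z \<longleftrightarrow> S = logistic (a0 + a1 * x)"
      unfolding Z_def S_def by auto
    also have "\<dots> \<longleftrightarrow> S - exp (a0 + a1 * x) * (1 - S) = 0"
      unfolding logistic_eq_iff_odds by simp
    also have "\<dots> \<longleftrightarrow> ?L (x / v) = 0"
      unfolding L[OF S_def, symmetric] by simp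
    finally show ?thesis .
  qed
  then have "(\<lambda>x. x / v) ` Z \<subseteq> {t. ?L t = 0}" by auto
  moreover have inj: "inj_on (\<lambda>x. x / v) Z" using v by (intro inj_onI) simp
  moreover note L_zeros = laplace_zeros[OF cont zeros(1) int]
  ultimately have "finite Z" "card Z \<le> card {t. ?L t = 0}"
    by (blast intro: inj_on_finite, blast intro: card_inj_on_le)
  then show ?thesis using L_zeros zeros(2) by linarith
qed

text \<open>Distinct curves would agree at no more than three points. The alternative
  \<open>a1 = 0\<close> is genuine: smoothing leaves a constant curve unchanged, whatever the
  variance.\<close>

lemma smoothed_logistic_identifiable:
  fixes T :: "real set"
  defines "F \<equiv> \<lambda>a0 a1 v x. \<integral>u. logistic (a0 + a1 * (x + u)) \<partial>normal_law v"
  assumes v: "0 \<le> v" "v \<le> w" and T: "4 \<le> card T"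
    and eq: "\<And>x. x \<in> T \<Longrightarrow> F a0 a1 v x = F b0 b1 w x"
  shows "a0 = b0 \<and> a1 = b1 \<and> (v = w \<or> a1 = 0)"
proof (rule ccontr)
  assume neg: "\<not> ?thesis"
  let ?D = "\<lambda>x. logistic (a0 + a1 * x) - F b0 b1 (w - v) x"
  interpret V: prob_space "normal_law v" using v prob_space_normal_law by simp
  interpret W: prob_space "normal_law (w - v)" using v prob_space_normal_law by simp
  have meas [measurable]: "(\<lambda>x. F c0 c1 (w - v) x) \<in> borel_measurable borel" for c0 c1
    unfolding F_def by measurable
  have int: "integrable (normal_law (w - v)) (\<lambda>u. logistic (c0 + c1 * (x + u)))" for c0 c1 x
    by (rule W.integrable_const_bound[where B = 1]) (auto simp: abs_logistic_le)
  have F01: "0 \<le> F c0 c1 (w - v) x" "F c0 c1 (w - v) x \<le> 1" for c0 c1 x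
    unfolding F_def
    by (intro W.integral_ge_const W.integral_le_const AE_I2 int
        less_imp_le[OF logistic_pos] less_imp_le[OF logistic_less_1])+
  have bound: "\<bar>?D x\<bar> \<le> 1" for x
    using F01[of b0 b1 x] logistic_pos[of "a0 + a1 * x"] logistic_less_1[of "a0 + a1 * x"] by linarith
  \<comment> \<open>The common part \<open>v\<close> of both variances is pulled out by the
    semigroup property, so \<open>?D\<close> compares an unsmoothed curve with one smoothed by the
    excess \<open>w - v\<close>.\<close>
  have D: "F a0 a1 v x - F b0 b1 w x = (\<integral>u. ?D (x + u) \<partial>normal_law v)" for x
  proof -
    have "F b0 b1 w x = (\<integral>s. F b0 b1 (w - v) (x + s) \<partial>normal_law v)"
      unfolding F_def
      using integral_normal_law_add[OF v, of "\<lambda>u. logistic (b0 + b1 * (x + u))" 1]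
      by (simp add: abs_logistic_le add.assoc)
    moreover have "integrable (normal_law v) (\<lambda>u. logistic (a0 + a1 * (x + u)))"
      by (rule V.integrable_const_bound[where B = 1]) (auto simp: abs_logistic_le)
    moreover have "integrable (normal_law v) (\<lambda>u. F b0 b1 (w - v) (x + u))"
      by (rule V.integrable_const_bound[where B = 1]) (auto simp: F01)
    moreover have "F a0 a1 v x = (\<integral>u. logistic (a0 + a1 * (x + u)) \<partial>normal_law v)"
      unfolding F_def ..
    ultimately show ?thesis by simp
  qed
  have cont: "continuous_on UNIV ?D"
  proof (cases "v = w")
    case True
    then show ?thesis
      unfolding F_def by (auto simp: integral_normal_law_0 intro!: continuous_intros)
  next
    case False
    then show ?thesis unfolding F_def using v
      by (intro continuous_intros continuous_on_normal_law_shift[where B = 1 and f = "\<lambda>y. logistic (b0 + b1 * y)"])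
        (auto simp: abs_logistic_le)
  qed
  have affine: "finite {x. c0 + c1 * x = 0} \<and> card {x. c0 + c1 * x = 0} \<le> 3"
    if "c0 \<noteq> 0 \<or> c1 \<noteq> 0" for c0 c1 :: real
  proof (cases "c1 = 0")
    case False
    then have "{x. c0 + c1 * x = 0} = {- c0 / c1}" by (auto simp: field_simps)
    then show ?thesis by simp
  qed (use that in simp)
  have "finite {x. ?D x = 0} \<and> card {x. ?D x = 0} \<le> 3"
  proof -
    \<comment> \<open>In the first case the excess smoothing does nothing, so injectivity of
      \<open>logistic\<close> reduces the zeros of \<open>?D\<close> to those of an affine function,
      nonzero by \<open>neg\<close>.\<close>
    consider "v = w \<or> b1 = 0" | "v < w" "a1 = 0" "b1 \<noteq> 0" | "v < w" "a1 \<noteq> 0" "b1 \<noteq> 0"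
      using v by linarith
    then show ?thesis
    proof cases
      case 1
      then have F_eq: "F b0 b1 (w - v) x = logistic (b0 + b1 * x)" for x
        unfolding F_def using W.prob_space by (auto simp: integral_normal_law_0)
      have "{x. ?D x = 0} = {x. (a0 - b0) + (a1 - b1) * x = 0}"
        unfolding F_eq by (auto simp: algebra_simps)
      then show ?thesis using affine[of "a0 - b0" "a1 - b1"] neg 1 by auto
    next
      case 2
      have "{y. logistic a0 - logistic (b0 + b1 * y) = 0} = {y. (b0 - a0) + b1 * y = 0}"
        by (auto simp: algebra_simps)
      then have fin: "finite {y. logistic a0 - logistic (b0 + b1 * y) = 0}"
        "card {y. logistic a0 - logistic (b0 + b1 * y) = 0} \<le> 3"
        using affine[of "b0 - a0" b1] 2 by auto
      \<comment> \<open>A constant may be moved under the smoothing, so \<open>?D\<close> is the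
        smoothing of a function with a single zero.\<close>
      have D_eq: "?D x = (\<integral>u. logistic a0 - logistic (b0 + b1 * (x + u)) \<partial>normal_law (w - v))" for x
        unfolding F_def using 2 int[of b0 b1 x] W.prob_space by simp
      have bound': "\<bar>logistic a0 - logistic (b0 + b1 * y)\<bar> \<le> 2" for y
        using abs_logistic_le[of a0] abs_logistic_le[of "b0 + b1 * y"] by linarith
      have "continuous_on UNIV (\<lambda>y. logistic a0 - logistic (b0 + b1 * y))"
        by (intro continuous_intros)
      from normal_smoothing_zeros[OF _ this bound' fin(1), of "w - v"] fin(2) v
      show ?thesis unfolding D_eq by simp
    next
      case 3
      then show ?thesis unfolding F_def using logistic_minus_smoothed_zeros[of "w - v"] by simp
    qed
  qed
  then have "finite {x. (\<integral>u. ?D (x + u) \<partial>normal_law v) = 0}"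
    "card {x. (\<integral>u. ?D (x + u) \<partial>normal_law v) = 0} \<le> 3"
    using normal_smoothing_zeros[OF v(1) cont bound] by auto
  moreover have "T \<subseteq> {x. (\<integral>u. ?D (x + u) \<partial>normal_law v) = 0}"
    using eq by (auto simp flip: D)
  ultimately have "card T \<le> 3" using card_mono order_trans by blast
  then show False using T by simp
qed

subsection \<open>The Berkson model\<close>

text \<open>Integrating the conditional probability gives the unconditional one, and the integral is
  then transported to the law of \<open>U n\<close>.\<close>

lemma (in berkson_logistic) prob_Y_eq_1:
  assumes n: "n \<in> {1..N}"
  shows "prob {\<omega> \<in> space M. Y n \<omega> = 1}
    = (\<integral>u. logistic (beta0 + beta1 * (xobs n + u)) \<partial>normal_law tausq)"
proof -
  note [measurable] = U_measurable[OF n] Y_measurable[OF n]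
  let ?G = "vimage_algebra (space M) (\<lambda>\<omega>. xobs n + U n \<omega>) borel"
  let ?A = "{\<omega> \<in> space M. Y n \<omega> = 1}"
  have "subalgebra M ?G"
    unfolding subalgebra_def by (auto intro!: measurable_sets simp: sets_vimage_algebra2)
  then interpret sigma_finite_subalgebra M ?G
    by (intro finite_measure_subalgebra_is_sigma_finite finite_measure_subalgebra.intro
        finite_measure_subalgebra_axioms.intro finite_measure_axioms)
  have A: "?A \<in> events"
    using measurable_sets[OF Y_measurable[OF n], of "{1}"] by (simp add: vimage_def Int_def conj_commute)
  then have "prob ?A = (\<integral>\<omega>. indicator ?A \<omega> \<partial>M)" by simp
  also have "\<dots> = (\<integral>\<omega>. real_cond_exp M ?G (indicator ?A) \<omega> \<partial>M)"
    using A by (intro real_cond_exp_int(2)[symmetric]) (simp add: integrable_indicator_iff less_top[symmetric])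
  also have "\<dots> = (\<integral>\<omega>. logistic (beta0 + beta1 * (xobs n + U n \<omega>)) \<partial>M)"
    using Y_cond_prob[OF n] by (intro integral_cong_AE) auto
  also have "\<dots> = (\<integral>u. logistic (beta0 + beta1 * (xobs n + u)) \<partial>distr M borel (U n))"
    by (subst integral_distr) auto
  finally show ?thesis unfolding U_law[OF n] .
qed

text \<open>Each success probability is read off from a marginal of the joint law, so equal
  observation laws give equal success probabilities.\<close>

lemma (in berkson_logistic) prob_Y_obs_law:
  assumes n: "n \<in> {1..N}"
  shows "prob {\<omega> \<in> space M. Y n \<omega> = 1}
    = measure (obs_law M N Y) {y \<in> space (Pi\<^sub>M {1..N} (\<lambda>_. count_space {0, 1})). y n = 1}"
proof -
  let ?P = "Pi\<^sub>M {1..N} (\<lambda>_. count_space {0, 1 :: nat})"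
  have Y: "(\<lambda>\<omega>. \<lambda>n\<in>{1..N}. Y n \<omega>) \<in> measurable M ?P"
    using Y_measurable by (rule measurable_restrict)
  have [measurable]: "(\<lambda>y. y n) \<in> measurable ?P (count_space {0, 1})"
    using n by (rule measurable_component_singleton)
  have "{y \<in> space ?P. y n = 1} \<in> sets ?P" 
    using measurable_sets[OF \<open>(\<lambda>y. y n) \<in> measurable ?P (count_space {0, 1})\<close>, of "{1}"]
    by (simp add: vimage_def Int_def conj_commute)
  then show ?thesis
    unfolding obs_law_def using Y n measurable_space[OF Y]
    by (subst measure_distr) (auto intro!: arg_cong[where f = prob])
qed

theorem theorem5:
  fixes M1 :: "'a measure" and M2 :: "'b measure"
    and N :: nat and xobs :: "nat \<Rightarrow> real"
    and a0 a1 v b0 b1 w :: real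
    and U1 :: "nat \<Rightarrow> 'a \<Rightarrow> real" and Y1 :: "nat \<Rightarrow> 'a \<Rightarrow> nat"
    and U2 :: "nat \<Rightarrow> 'b \<Rightarrow> real" and Y2 :: "nat \<Rightarrow> 'b \<Rightarrow> nat"
  assumes "4 \<le> card (xobs ` {1..N})"
    and "berkson_logistic M1 N xobs a0 a1 v U1 Y1"
    and "berkson_logistic M2 N xobs b0 b1 w U2 Y2"
    and "obs_law M1 N Y1 = obs_law M2 N Y2"
  shows "a0 = b0 \<and> a1 = b1 \<and> a1\<^sup>2 * v = b1\<^sup>2 * w"
proof -
  interpret M1: berkson_logistic M1 N xobs a0 a1 v U1 Y1 by fact
  interpret M2: berkson_logistic M2 N xobs b0 b1 w U2 Y2 by fact
  have eq: "(\<integral>u. logistic (a0 + a1 * (x + u)) \<partial>normal_law v)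
      = (\<integral>u. logistic (b0 + b1 * (x + u)) \<partial>normal_law w)" if "x \<in> xobs ` {1..N}" for x
    using that assms(4) M1.prob_Y_eq_1 M2.prob_Y_eq_1 M1.prob_Y_obs_law M2.prob_Y_obs_law by auto
  show ?thesis
  \<comment> \<open>The smaller variance has to come first; otherwise the two parameter sets
    exchange roles. Either equal variances or a zero slope makes the two products equal.\<close>
  proof (cases "v \<le> w")
    case True
    from smoothed_logistic_identifiable[OF M1.tausq_nonneg True assms(1) eq] show ?thesis by auto
  next
    case False
    then have "w \<le> v" by simp
    from smoothed_logistic_identifiable[OF M2.tausq_nonneg this assms(1) eq[symmetric]]
    show ?thesis by auto
  qed
qed

end
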